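(* Let $t\ge 2$ be an integer. Every $t$-CNF theory (respectively, every normal $t$-program, every disjunctive $t$-program) with $n$ atoms has at most $\alpha_t^n\le (2-1/2^t)^n$ minimal models (respectively, stable models, answer sets), where $\alpha_t$ is the unique positive root of $1+\tau+\tau^2+\cdots+\tau^{t-1}=\tau^t$.
   Context: A $t$-CNF theory is a finite set of propositional clauses, each containing at most $t$ literals (no repeated literal, no complementary pair). A normal program clause has the form $a \leftarrow b_1,\ldots,b_r,\mathbf{not}(c_1),\ldots,\mathbf{not}(c_s)$ and a disjunctive one the form $a_1\vee\cdots\vee a_p \leftarrow b_1,\ldots,b_r,\mathbf{not}(c_1),\ldots,\mathbf{not}(c_s)$; a (normal or disjunctive) $t$-program is a finite set of such clauses, each with at most $t$ literals. Models, stable models (Gelfond–Lifschitz) and answer sets (minimal models of the Gelfond–Lifschitz reduct $P^M$) are represented as sets of true atoms; a model is minimal if no proper subset is a model. $n$ is the number of atoms. *)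

theory Defs
  imports Complex_Main
begin

definition is_minimal_model :: "('a set \<Rightarrow> bool) \<Rightarrow> 'a set \<Rightarrow> bool" where
  "is_minimal_model is_model M \<longleftrightarrow> is_model M \<and> (\<forall>N. N \<subset> M \<longrightarrow> \<not> is_model N)"

definition is_least_model :: "('a set \<Rightarrow> bool) \<Rightarrow> 'a set \<Rightarrow> bool" where
  "is_least_model is_model M \<longleftrightarrow> is_model M \<and> (\<forall>N. is_model N \<longrightarrow> M \<subseteq> N)"

datatype 'a literal = Pos (lit_atom: 'a) | Neg (lit_atom: 'a)

type_synonym 'a clause = "'a literal set"

definition t_clause :: "nat \<Rightarrow> 'a clause \<Rightarrow> bool" where
  "t_clause t c \<longleftrightarrow> finite c \<and> card c \<le> t \<and> \<not> (\<exists>a. Pos a \<in> c \<and> Neg a \<in> c)"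

definition t_cnf :: "nat \<Rightarrow> 'a clause set \<Rightarrow> bool" where
  "t_cnf t T \<longleftrightarrow> finite T \<and> (\<forall>c\<in>T. t_clause t c)"

definition cnf_atoms :: "'a clause set \<Rightarrow> 'a set" where
  "cnf_atoms T = (\<Union>c\<in>T. lit_atom ` c)"

fun lit_true :: "'a set \<Rightarrow> 'a literal \<Rightarrow> bool" where
  "lit_true M (Pos a) \<longleftrightarrow> a \<in> M"
| "lit_true M (Neg a) \<longleftrightarrow> a \<notin> M"

definition cnf_model :: "'a clause set \<Rightarrow> 'a set \<Rightarrow> bool" where
  "cnf_model T M \<longleftrightarrow> (\<forall>c\<in>T. \<exists>l\<in>c. lit_true M l)"

text \<open>
  \<open>Rule H B C\<close> stands for the program clause with head atoms \<open>H\<close>, positive body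
  atoms \<open>B\<close>, and negated body literals \<open>not(c)\<close> for \<open>c\<close> in \<open>C\<close>. Empty heads
  (constraints) are allowed in disjunctive programs.
\<close>

datatype 'a rule = Rule (head: "'a set") (pos_body: "'a set") (neg_body: "'a set")

definition t_rule :: "nat \<Rightarrow> 'a rule \<Rightarrow> bool" where
  "t_rule t r \<longleftrightarrow> finite (head r) \<and> finite (pos_body r) \<and> finite (neg_body r) \<and>
     card (head r) + card (pos_body r) + card (neg_body r) \<le> t"

definition disjunctive_t_program :: "nat \<Rightarrow> 'a rule set \<Rightarrow> bool" where
  "disjunctive_t_program t P \<longleftrightarrow> finite P \<and> (\<forall>r\<in>P. t_rule t r)"

definition normal_t_program :: "nat \<Rightarrow> 'a rule set \<Rightarrow> bool" where
  "normal_t_program t P \<longleftrightarrow> finite P \<and> (\<forall>r\<in>P. t_rule t r \<and> (\<exists>a. head r = {a}))"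

definition prog_atoms :: "'a rule set \<Rightarrow> 'a set" where
  "prog_atoms P = (\<Union>r\<in>P. head r \<union> pos_body r \<union> neg_body r)"

definition prog_model :: "'a rule set \<Rightarrow> 'a set \<Rightarrow> bool" where
  "prog_model P M \<longleftrightarrow>
     (\<forall>r\<in>P. pos_body r \<subseteq> M \<and> neg_body r \<inter> M = {} \<longrightarrow> head r \<inter> M \<noteq> {})"

definition reduct :: "'a rule set \<Rightarrow> 'a set \<Rightarrow> 'a rule set" where
  "reduct P M = {Rule (head r) (pos_body r) {} | r. r \<in> P \<and> neg_body r \<inter> M = {}}"

definition stable_model :: "'a rule set \<Rightarrow> 'a set \<Rightarrow> bool" where
  "stable_model P M \<longleftrightarrow> is_least_model (prog_model (reduct P M)) M"

definition answer_set :: "'a rule set \<Rightarrow> 'a set \<Rightarrow> bool" where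
  "answer_set P M \<longleftrightarrow> is_minimal_model (prog_model (reduct P M)) M"

definition is_alpha :: "nat \<Rightarrow> real \<Rightarrow> bool" where
  "is_alpha t \<tau> \<longleftrightarrow> \<tau> > 0 \<and> (\<Sum>i<t. \<tau> ^ i) = \<tau> ^ t"

definition alpha :: "nat \<Rightarrow> real" where
  "alpha t = (THE \<tau>. is_alpha t \<tau>)"

end

theory Submission
  imports Defs
begin

text \<open>
  Minimal models of a CNF theory and stable models of a normal program are answer sets of a
  disjunctive program, so only answer sets need to be counted. Fix the truth values of some atoms
  and let \<open>I\<close> be the set of atoms made true. If this already satisfies every rule, then \<open>I\<close> is
  itself a model of the reduct by any answer set extending it, and minimality leaves only \<open>I\<close>.
  Otherwise some rule has \<open>k \<le> t\<close> undecided literals, one of which must become true; branching on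
  the first true one fixes \<open>1, \<dots>, k\<close> further atoms, which is the recursion
  \<open>F m \<le> F (m - 1) + \<dots> + F (m - t)\<close> solved by \<open>F m = \<alpha> ^ m\<close>.
\<close>

section \<open>The root\<close>

text \<open>Dividing by \<open>x ^ t\<close> turns the equation into 1 = 1/x + ... + 1/x^t, whose
  right side is strictly decreasing for x > 0. The proof compares the sums termwise with
  denominators cleared.\<close>

lemma is_alpha_unique:
  assumes "t > 0" "is_alpha t x" "is_alpha t y"
  shows "x = y"
proof -
  have no: False if "is_alpha t x" "is_alpha t y" "x < y" for x y
  proof -
    have pos: "x > 0" "y > 0"
      and sums: "(\<Sum>i<t. x ^ i) = x ^ t" "(\<Sum>i<t. y ^ i) = y ^ t"
      using that by (auto simp: is_alpha_def)
    have "x ^ t * y ^ t = (\<Sum>i<t. x ^ t * y ^ i)"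
      by (simp add: sums(2)[symmetric] sum_distrib_left)
    also have "\<dots> < (\<Sum>i<t. y ^ t * x ^ i)"
    proof (rule sum_strict_mono)
      fix i assume "i \<in> {..<t}"
      then have i: "i < t" by simp
      have "x ^ t * y ^ i = (x * y) ^ i * x ^ (t - i)"
        using i by (simp add: power_mult_distrib mult.commute mult.left_commute flip: power_add)
      also have "\<dots> < (x * y) ^ i * y ^ (t - i)"
        using pos that(3) i by (intro mult_strict_left_mono power_strict_mono) auto
      also have "\<dots> = y ^ t * x ^ i"
        using i by (simp add: power_mult_distrib mult.assoc mult.commute flip: power_add)
      finally show "x ^ t * y ^ i < y ^ t * x ^ i" .
    qed (use assms(1) in auto)
    also have "\<dots> = x ^ t * y ^ t"
      by (simp add: sums(1) flip: sum_distrib_left)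
    finally show False by simp
  qed
  show ?thesis
    using no assms(2,3) by (meson linorder_less_linear)
qed

lemma is_alpha_exists:
  assumes "t \<ge> 2"
  obtains x where "is_alpha t x" "x \<le> 2 - 1 / 2 ^ t"
proof -
  define g :: "real \<Rightarrow> real" where "g x = x ^ t - (\<Sum>i<t. x ^ i)" for x
  define b :: real where "b = 2 - 1 / 2 ^ t"
  have "(2::real) ^ 1 \<le> 2 ^ t"
    using assms by (intro power_increasing) auto
  then have b: "1 < b" "b < 2"
    by (auto simp: b_def field_simps)
  \<comment> \<open>Multiplying \<open>g b\<close> by the positive factor \<open>b - 1\<close>
    telescopes the sum. Since \<open>2 - b\<close> equals 1 / 2^t, what remains is 1 - (b/2)^t, so
    the sign of \<open>g b\<close> can be read off.\<close>
  have "(b - 1) * (\<Sum>i<t. b ^ i) = b ^ t - 1"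
    by (simp add: power_diff_1_eq)
  then have "(b - 1) * g b = 1 - b ^ t * (2 - b)"
    by (simp add: g_def algebra_simps)
  also have "\<dots> = 1 - (b / 2) ^ t"
    by (simp add: b_def power_divide)
  also have "\<dots> \<ge> 0"
    using b by (simp add: power_le_one)
  finally have "0 \<le> g b"
    using b by (simp add: zero_le_mult_iff)
  moreover have "g 1 \<le> 0"
    using assms by (simp add: g_def)
  moreover have "continuous_on {1..b} g"
    unfolding g_def by (intro continuous_intros)
  ultimately obtain x where "1 \<le> x" "x \<le> b" "g x = 0"
    using IVT'[of g 1 0 b] b by auto
  then show ?thesis
    by (intro that[of x]) (auto simp: is_alpha_def g_def b_def)
qed

lemma is_alpha_ge_1:
  assumes "t > 0" "is_alpha t x"
  shows "x \<ge> 1"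
proof (rule ccontr)
  assume "\<not> x \<ge> 1"
  with assms have "0 < x" "x < 1"
    by (auto simp: is_alpha_def)
  then have "x ^ t < 1"
    using assms(1) by (simp add: power_less_one_iff)
  moreover have "x ^ 0 \<le> (\<Sum>i<t. x ^ i)"
    using assms(1) \<open>0 < x\<close> by (intro member_le_sum) auto
  ultimately show False
    using assms(2) by (simp add: is_alpha_def)
qed

text \<open>Multiplied by \<open>x ^ (t - k)\<close>, the left side becomes the top k terms of the
  full sum, which equals \<open>x ^ t\<close>. This handles clauses with fewer than t undecided
  literals.\<close>

lemma is_alpha_partial_sum_le:
  assumes "is_alpha t x" "k \<le> t"
  shows "(\<Sum>i<k. x ^ i) \<le> x ^ k"
proof -
  have x: "x > 0" "(\<Sum>i<t. x ^ i) = x ^ t"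
    using assms(1) by (auto simp: is_alpha_def)
  have "x ^ (t - k) * (\<Sum>i<k. x ^ i) = (\<Sum>i<k. x ^ (i + (t - k)))"
    by (simp add: sum_distrib_left power_add mult.commute[of "x ^ (t - k)"])
  also have "\<dots> = (\<Sum>j\<in>{t-k..<t}. x ^ j)"
    using assms(2) sum.shift_bounds_nat_ivl[of "\<lambda>j. x ^ j" 0 "t - k" k]
    by (simp add: lessThan_atLeast0)
  also have "\<dots> \<le> (\<Sum>i<t. x ^ i)"
    using x(1) by (intro sum_mono2) auto
  also have "\<dots> = x ^ (t - k) * x ^ k"
    using assms(2) x(2) by (simp flip: power_add)
  finally show ?thesis
    using x(1) by simp
qed

section \<open>Counting by branching\<close>

text \<open>
  \<open>{M \<in> S. M - V = I}\<close> collects the members of \<open>S\<close> extending the partial assignment with undecided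
  atoms \<open>V\<close> and true atoms \<open>I\<close>. The condition \<open>\<exists>a\<in>U. a \<in> M \<longleftrightarrow> a \<in> H\<close> is a clause over the atoms
  \<open>U\<close> in which exactly the atoms of \<open>H\<close> occur positively.
\<close>

lemma card_clause_branch_le:
  fixes S :: "'a set set" and x :: real
  assumes "finite U" "U \<subseteq> V" "finite V" "finite S"
    and "\<And>V' I. V' \<subset> V \<Longrightarrow> real (card {M \<in> S. M - V' = I}) \<le> x ^ card V'"
  shows "real (card {M \<in> S. M - V = I \<and> (\<exists>a\<in>U. a \<in> M \<longleftrightarrow> a \<in> H)})
         \<le> x ^ (card V - card U) * (\<Sum>i<card U. x ^ i)"
  using assms
proof (induction U arbitrary: V I rule: finite_induct)
  case empty
  then show ?case by simp
next
  case (insert b U)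
  let ?W = "V - {b}"
  define J where "J c = (if c then insert b I else I)" for c
  have W: "?W \<subset> V" "U \<subseteq> ?W" "finite ?W"
    using insert.prems insert.hyps by auto
  have cards: "card ?W = card V - 1" "Suc (card U) \<le> card V"
    using insert.prems insert.hyps card_mono[of V "insert b U"] by auto
  \<comment> \<open>In \<open>A\<close> the literal on \<open>b\<close> is true and the clause is
    settled. In \<open>B\<close> it is false, so the clause must be satisfied on the rest of
    \<open>U\<close>.\<close>
  define A where "A = {M \<in> S. M - ?W = J (b \<in> H)}"
  define B where "B = {M \<in> S. M - ?W = J (b \<notin> H) \<and> (\<exists>a\<in>U. a \<in> M \<longleftrightarrow> a \<in> H)}"
  have "{M \<in> S. M - V = I \<and> (\<exists>a\<in>insert b U. a \<in> M \<longleftrightarrow> a \<in> H)} \<subseteq> A \<union> B"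
  proof
    fix M assume M: "M \<in> {M \<in> S. M - V = I \<and> (\<exists>a\<in>insert b U. a \<in> M \<longleftrightarrow> a \<in> H)}"
    then have "M - ?W = J (b \<in> M)"
      using insert.prems(1) by (auto simp: J_def)
    with M show "M \<in> A \<union> B"
      by (cases "b \<in> M \<longleftrightarrow> b \<in> H") (auto simp: A_def B_def)
  qed
  then have "card {M \<in> S. M - V = I \<and> (\<exists>a\<in>insert b U. a \<in> M \<longleftrightarrow> a \<in> H)} \<le> card (A \<union> B)"
    by (intro card_mono) (auto simp: A_def B_def insert.prems)
  also have "\<dots> \<le> card A + card B"
    by (rule card_Un_le)
  finally have "real (card {M \<in> S. M - V = I \<and> (\<exists>a\<in>insert b U. a \<in> M \<longleftrightarrow> a \<in> H)})
      \<le> real (card A) + real (card B)"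
    by linarith
  also have "real (card A) \<le> x ^ card ?W"
    unfolding A_def by (rule insert.prems(4)[OF W(1)])
  also have "real (card B) \<le> x ^ (card ?W - card U) * (\<Sum>i<card U. x ^ i)"
    unfolding B_def using W(1) insert.prems(3,4)
    by (intro insert.IH[OF W(2,3)]) auto
  \<comment> \<open>The bound for \<open>A\<close> supplies the top term that extends the sum over
    \<open>i < card U\<close> by one.\<close>
  also have "x ^ card ?W = x ^ (card ?W - card U) * x ^ card U"
    using cards by (simp flip: power_add)
  finally show ?case
    using cards insert.hyps by (simp add: algebra_simps)
qed

text \<open>Induction on the undecided set \<open>V\<close>. A leaf contributes at most 1 \<le>
  \<open>x ^ card V\<close>; at a branching node the induction hypothesis gives a partial sum of
  powers, absorbed by \<open>is_alpha_partial_sum_le\<close>. An empty \<open>U\<close> encodes a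
  contradictory node.\<close>

lemma card_branching_le:
  fixes S :: "'a set set"
  assumes alpha: "t > 0" "is_alpha t x" and "finite V" "finite S"
    and branch: "\<And>V' I. V' \<subseteq> V \<Longrightarrow>
      (\<exists>N. \<forall>M\<in>S. M - V' = I \<longrightarrow> M = N) \<or>
      (\<exists>U H. U \<subseteq> V' \<and> card U \<le> t \<and> (\<forall>M\<in>S. M - V' = I \<longrightarrow> (\<exists>a\<in>U. a \<in> M \<longleftrightarrow> a \<in> H)))"
  shows "real (card {M \<in> S. M - V = I}) \<le> x ^ card V"
  using assms(3) branch
proof (induction V arbitrary: I rule: finite_psubset_induct)
  case (psubset V)
  have x: "x \<ge> 1"
    using is_alpha_ge_1[OF alpha] .
  have IH: "real (card {M \<in> S. M - V' = I}) \<le> x ^ card V'" if "V' \<subset> V" for V' I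
    using psubset.prems that by (intro psubset.IH) (auto 0 3)
  from psubset.prems[OF subset_refl, of I] show ?case
  proof (elim disjE exE conjE)
    fix N assume "\<forall>M\<in>S. M - V = I \<longrightarrow> M = N"
    then have "{M \<in> S. M - V = I} \<subseteq> {N}" by blast
    then have "card {M \<in> S. M - V = I} \<le> 1"
      using card_mono[of "{N}"] by force
    then have "real (card {M \<in> S. M - V = I}) \<le> 1" by simp
    also have "1 \<le> x ^ card V"
      using x by simp
    finally show ?case .
  next
    fix U H
    assume 2: "U \<subseteq> V" "card U \<le> t" "\<forall>M\<in>S. M - V = I \<longrightarrow> (\<exists>a\<in>U. a \<in> M \<longleftrightarrow> a \<in> H)"
    have U: "finite U" "card U \<le> card V"
      using 2 psubset.hyps by (auto intro: finite_subset card_mono)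
    have "{M \<in> S. M - V = I} = {M \<in> S. M - V = I \<and> (\<exists>a\<in>U. a \<in> M \<longleftrightarrow> a \<in> H)}"
      using 2(3) by (intro Collect_cong) metis
    also have "real (card \<dots>) \<le> x ^ (card V - card U) * (\<Sum>i<card U. x ^ i)"
      by (rule card_clause_branch_le[OF U(1) 2(1) psubset.hyps assms(4) IH])
    also have "\<dots> \<le> x ^ (card V - card U) * x ^ card U"
      using x is_alpha_partial_sum_le[OF alpha(2) 2(2)] by (intro mult_left_mono) auto
    also have "\<dots> = x ^ card V"
      using U by (simp flip: power_add)
    finally show ?case .
  qed
qed

section \<open>Answer sets\<close>

lemma prog_model_reduct_iff:
  "prog_model (reduct P M) N \<longleftrightarrow>
     (\<forall>r\<in>P. neg_body r \<inter> M = {} \<and> pos_body r \<subseteq> N \<longrightarrow> head r \<inter> N \<noteq> {})"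
  unfolding prog_model_def reduct_def by fastforce

lemma answer_set_minimal:
  assumes "answer_set P M" "N \<subseteq> M" "prog_model (reduct P M) N"
  shows "N = M"
  using assms unfolding answer_set_def is_minimal_model_def by blast

text \<open>Discarding foreign atoms from \<open>M\<close> leaves a model of the reduct, because
  every head lies in \<open>prog_atoms P\<close>; minimality then forces equality.\<close>

lemma answer_set_subset_atoms:
  assumes "answer_set P M"
  shows "M \<subseteq> prog_atoms P"
proof -
  have "prog_model (reduct P M) M"
    using assms by (simp add: answer_set_def is_minimal_model_def)
  moreover have "head r \<subseteq> prog_atoms P" if "r \<in> P" for r
    using that unfolding prog_atoms_def by blast
  ultimately have "prog_model (reduct P M) (M \<inter> prog_atoms P)"
    unfolding prog_model_reduct_iff by (metis Int_absorb2 inf.assoc inf.commute inf.boundedE)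
  then have "M \<inter> prog_atoms P = M"
    using answer_set_minimal[OF assms] by blast
  then show ?thesis by blast
qed

lemma answer_set_branch:
  assumes P: "disjunctive_t_program t P"
  shows "(\<exists>N. \<forall>M\<in>{M. answer_set P M}. M - V = I \<longrightarrow> M = N) \<or>
    (\<exists>U H. U \<subseteq> V \<and> card U \<le> t \<and>
      (\<forall>M\<in>{M. answer_set P M}. M - V = I \<longrightarrow> (\<exists>a\<in>U. a \<in> M \<longleftrightarrow> a \<in> H)))"
proof -
  text \<open>The last disjunct covers tautological rules, which never constrain an answer set.\<close>
  define sat where "sat r \<longleftrightarrow> (head r \<union> neg_body r) \<inter> I \<noteq> {} \<or> \<not> pos_body r \<subseteq> I \<union> V \<or>
    pos_body r \<inter> (head r \<union> neg_body r) \<noteq> {}" for r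
  show ?thesis
  proof (cases "\<forall>r\<in>P. sat r")
    case True
    have "M = I" if M: "answer_set P M" "M - V = I" for M
    proof -
      \<comment> \<open>Here \<open>I\<close> is a subset of \<open>M\<close>. Hence a rule whose
        \<open>neg_body\<close> meets \<open>I\<close> is absent from the reduct, and one whose
        \<open>pos_body\<close> meets its \<open>neg_body\<close> is either absent or has a body
        false in \<open>I\<close>.\<close>
      have "prog_model (reduct P M) I"
        using True M(2) unfolding prog_model_reduct_iff sat_def by fast
      then show ?thesis
        using answer_set_minimal[OF M(1)] M(2) by blast
    qed
    then show ?thesis
      by (intro disjI1 exI[of _ I]) simp
  next
    case False
    then obtain r where r: "r \<in> P" "\<not> sat r" by blast
    \<comment> \<open>Read as a clause, the rule has the atoms of \<open>H\<close> as positive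
      literals and those of \<open>pos_body r\<close> as negative ones. As \<open>r\<close> is not
      tautological, these sets are disjoint, so membership in \<open>H\<close> determines the
      sign.\<close>
    define H where "H = head r \<union> neg_body r"
    define U where "U = (H \<union> pos_body r) \<inter> V"
    have "t_rule t r"
      using P r(1) by (simp add: disjunctive_t_program_def)
    then have fin: "finite (head r)" "finite (pos_body r)" "finite (neg_body r)"
      and le: "card (head r) + card (pos_body r) + card (neg_body r) \<le> t"
      by (auto simp: t_rule_def)
    have "card U \<le> card (H \<union> pos_body r)"
      unfolding U_def H_def using fin by (intro card_mono) auto
    also have "\<dots> \<le> card (head r) + card (neg_body r) + card (pos_body r)"
      unfolding H_def by (meson add_le_mono1 card_Un_le order_trans)
    finally have "card U \<le> t"
      using le by linarith
    moreover have "\<exists>a\<in>U. a \<in> M \<longleftrightarrow> a \<in> H" if M: "answer_set P M" "M - V = I" for M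
    proof -
      have "prog_model (reduct P M) M"
        using M(1) by (simp add: answer_set_def is_minimal_model_def)
      then have "H \<inter> M \<noteq> {} \<or> \<not> pos_body r \<subseteq> M"
        using r(1) unfolding prog_model_reduct_iff H_def by blast
      then show ?thesis
        using r(2) M(2) unfolding sat_def U_def H_def by blast
    qed
    ultimately show ?thesis
      by (intro disjI2 exI[of _ U] exI[of _ H]) (simp add: U_def)
  qed
qed

lemma answer_sets_bound:
  assumes "t > 0" "is_alpha t x" "disjunctive_t_program t P"
  shows "finite {M. answer_set P M} \<and> real (card {M. answer_set P M}) \<le> x ^ card (prog_atoms P)"
proof
  have atoms: "finite (prog_atoms P)"
    using assms(3) by (auto simp: disjunctive_t_program_def t_rule_def prog_atoms_def)
  show fin: "finite {M. answer_set P M}"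
    by (rule finite_subset[of _ "Pow (prog_atoms P)"]) (use atoms answer_set_subset_atoms in auto)
  \<comment> \<open>The branching starts with every atom undecided and none made true.\<close>
  have "{M. answer_set P M} = {M \<in> {M. answer_set P M}. M - prog_atoms P = {}}"
    using answer_set_subset_atoms by auto
  then show "real (card {M. answer_set P M}) \<le> x ^ card (prog_atoms P)"
    using card_branching_le[OF assms(1,2) atoms fin answer_set_branch[OF assms(3)], where I = "{}"]
    by simp
qed

lemma stable_model_imp_answer_set: "stable_model P M \<Longrightarrow> answer_set P M"
  unfolding stable_model_def answer_set_def is_least_model_def is_minimal_model_def by blast

lemma normal_imp_disjunctive: "normal_t_program t P \<Longrightarrow> disjunctive_t_program t P"
  by (simp add: normal_t_program_def disjunctive_t_program_def)

section \<open>CNF theories as programs\<close>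

text \<open>Negative literals go to the positive body rather than under \<open>not\<close>, so the
  reduct leaves the program unchanged and its answer sets are its minimal models.\<close>

definition rule_of_clause :: "'a clause \<Rightarrow> 'a rule" where
  "rule_of_clause c = Rule {a. Pos a \<in> c} {a. Neg a \<in> c} {}"

lemma clause_atoms: "lit_atom ` c = {a. Pos a \<in> c} \<union> {a. Neg a \<in> c}"
proof (intro set_eqI iffI)
  fix a assume "a \<in> lit_atom ` c"
  then obtain l where "l \<in> c" "a = lit_atom l" by blast
  then show "a \<in> {a. Pos a \<in> c} \<union> {a. Neg a \<in> c}"
    by (cases l) auto
next
  fix a assume "a \<in> {a. Pos a \<in> c} \<union> {a. Neg a \<in> c}"
  then show "a \<in> lit_atom ` c"
    by (metis CollectD Un_iff image_eqI literal.sel)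
qed

lemma prog_atoms_rule_of_clause: "prog_atoms (rule_of_clause ` T) = cnf_atoms T"
  by (simp add: prog_atoms_def cnf_atoms_def rule_of_clause_def clause_atoms)

lemma ex_lit_true_iff: "(\<exists>l\<in>c. lit_true M l) \<longleftrightarrow> (\<exists>a\<in>M. Pos a \<in> c) \<or> (\<exists>a. a \<notin> M \<and> Neg a \<in> c)"
  by (metis lit_true.elims(2) lit_true.simps)

lemma answer_set_rule_of_clause_iff:
  "answer_set (rule_of_clause ` T) M \<longleftrightarrow> is_minimal_model (cnf_model T) M"
proof -
  have "prog_model (reduct (rule_of_clause ` T) M) N \<longleftrightarrow> cnf_model T N" for N
    unfolding prog_model_reduct_iff cnf_model_def ball_simps(9) ex_lit_true_iff
    by (intro ball_cong refl) (simp add: rule_of_clause_def, blast)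
  then have "prog_model (reduct (rule_of_clause ` T) M) = cnf_model T"
    by blast
  then show ?thesis
    by (simp add: answer_set_def)
qed

lemma t_rule_rule_of_clause:
  assumes "t_clause t c"
  shows "t_rule t (rule_of_clause c)"
proof -
  let ?p = "{a. Pos a \<in> c}" and ?n = "{a. Neg a \<in> c}"
  have c: "finite c" "card c \<le> t" "?p \<inter> ?n = {}"
    using assms by (auto simp: t_clause_def)
  have fin: "finite ?p" "finite ?n"
    using finite_imageI[OF c(1), of lit_atom] unfolding clause_atoms by auto
  \<comment> \<open>Without complementary pairs no atom is counted twice.\<close>
  then have "card ?p + card ?n = card (lit_atom ` c)"
    using c(3) by (simp add: clause_atoms card_Un_disjoint)
  also have "\<dots> \<le> t"
    using card_image_le[OF c(1), of lit_atom] c(2) by linarith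
  finally show ?thesis
    using fin by (simp add: t_rule_def rule_of_clause_def)
qed

lemma disjunctive_rule_of_clause:
  "t_cnf t T \<Longrightarrow> disjunctive_t_program t (rule_of_clause ` T)"
  by (auto simp: t_cnf_def disjunctive_t_program_def t_rule_rule_of_clause)

theorem theorem8p2:
  fixes t :: nat
  assumes "t \<ge> 2"
  shows "(\<exists>!\<tau>. is_alpha t \<tau>) \<and>
    (\<forall>n::nat. alpha t ^ n \<le> (2 - 1 / 2 ^ t) ^ n) \<and>
    (\<forall>T :: 'a clause set. t_cnf t T \<longrightarrow>
       finite {M. is_minimal_model (cnf_model T) M} \<and>
       real (card {M. is_minimal_model (cnf_model T) M}) \<le> alpha t ^ card (cnf_atoms T)) \<and>
    (\<forall>P :: 'a rule set. normal_t_program t P \<longrightarrow>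
       finite {M. stable_model P M} \<and>
       real (card {M. stable_model P M}) \<le> alpha t ^ card (prog_atoms P)) \<and>
    (\<forall>P :: 'a rule set. disjunctive_t_program t P \<longrightarrow>
       finite {M. answer_set P M} \<and>
       real (card {M. answer_set P M}) \<le> alpha t ^ card (prog_atoms P))"
proof -
  have t: "t > 0"
    using assms by simp
  obtain x where x: "is_alpha t x" "x \<le> 2 - 1 / 2 ^ t"
    using is_alpha_exists[OF assms] .
  have ex1: "\<exists>!\<tau>. is_alpha t \<tau>"
    using x(1) is_alpha_unique[OF t] by blast
  then have alpha: "alpha t = x"
    unfolding alpha_def using x(1) by (rule the1_equality)
  have "x > 0"
    using x(1) by (simp add: is_alpha_def)
  then have bound: "x ^ n \<le> (2 - 1 / 2 ^ t) ^ n" for n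
    using x(2) by (intro power_mono) auto
  note answer = answer_sets_bound[OF t x(1)]
  have cnf: "finite {M. is_minimal_model (cnf_model T) M} \<and>
      real (card {M. is_minimal_model (cnf_model T) M}) \<le> x ^ card (cnf_atoms T)"
    if "t_cnf t T" for T :: "'a clause set"
    using answer[OF disjunctive_rule_of_clause[OF that]]
    by (simp add: answer_set_rule_of_clause_iff prog_atoms_rule_of_clause)
  have normal: "finite {M. stable_model P M} \<and>
      real (card {M. stable_model P M}) \<le> x ^ card (prog_atoms P)"
    if "normal_t_program t P" for P :: "'a rule set"
  proof -
    note P = answer[OF normal_imp_disjunctive[OF that]]
    have sub: "{M. stable_model P M} \<subseteq> {M. answer_set P M}"
      using stable_model_imp_answer_set by blast
    then have "card {M. stable_model P M} \<le> card {M. answer_set P M}"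
      using P by (intro card_mono) auto
    then show ?thesis
      using P finite_subset[OF sub] by force
  qed
  show ?thesis
    unfolding alpha using ex1 bound cnf normal answer by blast
qed

end
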